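(* Let $k\ge 2$, $n=n_1+\dots+n_k$, $m=m_1+\dots+m_k$, and let $A\in\mathbb{R}^{n\times n}$, $B\in\mathbb{R}^{n\times m}$, $Q\in\mathbb{R}^{n\times n}$, $R\in\mathbb{R}^{m\times m}$ all be block diagonal with respect to these partitions (the linear discrete time system is uncoupled), with $Q$ and $R$ symmetric positive definite. For fixed $B,Q,R$ let $P(A)$ denote the unique symmetric positive definite solution of the discrete Riccati equation $$P = A^T\left(P-P B\left(R+B^TP B\right)^{-1}B^TP\right)A+Q$$ as a function of the (not necessarily block diagonal) matrix $A$, and let $DP(A)$ be its derivative at the given block diagonal $A$. Write $P=P(A)$ and $A_{cl} = A-B(R+B^TPB)^{-1}B^TPA$. Then for every perturbation $\delta A\in\mathbb{R}^{n\times n}$ and all $i,j\in\{1,\dots,k\}$, $$ \left\|(DP(A)\cdot\delta A)_{i,j}\right\|_F \le \frac{\|P_{i,i} (A_{cl})_{i,i}\|_F+\|(A_{cl})_{j,j}^T P_{j,j}\|_F}{\mathrm{sep}^{\#}\big((A_{cl})_{i,i},(A_{cl})_{j,j}\big)}\max\big\{\|\delta A_{i,j}\|_F,\|\delta A_{j,i}\|_F\big\}. $$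
   Context: For $X\in\mathbb{R}^{n\times n}$, $X_{i,j}\in\mathbb{R}^{n_i\times n_j}$ denotes the $(i,j)$ block of $X$ with respect to the partition $n=n_1+\dots+n_k$; $B$ has diagonal blocks $B_{i,i}\in\mathbb{R}^{n_i\times m_i}$ and $R$ has diagonal blocks $R_{i,i}\in\mathbb{R}^{m_i\times m_i}$. $\|\cdot\|_F$ is the Frobenius norm. For square matrices $M_1,M_2$, $\mathrm{sep}^{\#}(M_1,M_2):=\sigma_{\min}(I-M_1^T\otimes M_2^T)$, where $\sigma_{\min}$ is the smallest singular value and $\otimes$ the Kronecker product. The setting is the discrete-time linear quadratic regulator $x_{l+1}=Ax_l+Bu_l$ with cost $\sum_{l\ge 0} x_l^TQx_l+u_l^TRu_l$. Standing assumption: the discrete Riccati equation has a unique symmetric positive definite solution for the given $A$ and for all matrices in a neighborhood of it, so that $P(\cdot)$ is defined and differentiable there; $A_{cl}$ is the closed-loop matrix under the optimal feedback $u(x)=-(R+B^TPB)^{-1}B^TPAx$. *)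

theory Defs
  imports "Jordan_Normal_Form.Char_Poly" "HOL-Analysis.Analysis"
begin

(* The system matrices have type real^'c^'r, a normed space, so that has_derivative applies to the
   solution map of the Riccati equation.  Their blocks, whose sizes vary with the block indices,
   have type real mat. *)

no_notation Matrix.vec_index (infixl "$" 100)
no_notation Matrix.scalar_prod (infix "\<bullet>" 70)

hide_const (open) Matrix.mat Matrix.vec

definition sym_pos_def :: "real^'n^'n \<Rightarrow> bool" where
  "sym_pos_def M \<longleftrightarrow> transpose M = M \<and> (\<forall>x. x \<noteq> 0 \<longrightarrow> 0 < x \<bullet> (M *v x))"

definition dare :: "real^'m^'n \<Rightarrow> real^'n^'n \<Rightarrow> real^'m^'m \<Rightarrow> real^'n^'n \<Rightarrow> real^'n^'n \<Rightarrow> bool" where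
  "dare B Q R A P \<longleftrightarrow>
     P = transpose A ** (P - P ** B ** matrix_inv (R + transpose B ** P ** B) ** transpose B ** P) ** A + Q"

(* Meaningful only where the symmetric positive definite solution exists and is unique. *)
definition dare_sol :: "real^'m^'n \<Rightarrow> real^'n^'n \<Rightarrow> real^'m^'m \<Rightarrow> real^'n^'n \<Rightarrow> real^'n^'n" where
  "dare_sol B Q R A = (THE P. sym_pos_def P \<and> dare B Q R A P)"

definition closed_loop ::
    "real^'m^'n \<Rightarrow> real^'m^'m \<Rightarrow> real^'n^'n \<Rightarrow> real^'n^'n \<Rightarrow> real^'n^'n" where
  "closed_loop B R A P =
     A - B ** matrix_inv (R + transpose B ** P ** B) ** transpose B ** P ** A"

(* A finite type carries no canonical order, so the coordinates are listed by an explicit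
   enumeration e; the first ns 0 of them form block 0, the next ns 1 form block 1, and so on.
   Blocks are numbered from 0. *)
definition partition_enum :: "nat \<Rightarrow> (nat \<Rightarrow> nat) \<Rightarrow> (nat \<Rightarrow> 'n::finite) \<Rightarrow> bool" where
  "partition_enum k ns e \<longleftrightarrow> (\<forall>i<k. 0 < ns i) \<and> bij_betw e {..<(\<Sum>i<k. ns i)} UNIV"

definition block ::
    "(nat \<Rightarrow> nat) \<Rightarrow> (nat \<Rightarrow> 'r) \<Rightarrow> (nat \<Rightarrow> nat) \<Rightarrow> (nat \<Rightarrow> 'c) \<Rightarrow> real^'c^'r \<Rightarrow> nat \<Rightarrow> nat \<Rightarrow> real mat" where
  "block ns e ms f X i j =
     Matrix.mat (ns i) (ms j) (\<lambda>(a, b). X $ e ((\<Sum>l<i. ns l) + a) $ f ((\<Sum>l<j. ms l) + b))"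

definition block_diagonal ::
    "nat \<Rightarrow> (nat \<Rightarrow> nat) \<Rightarrow> (nat \<Rightarrow> 'r) \<Rightarrow> (nat \<Rightarrow> nat) \<Rightarrow> (nat \<Rightarrow> 'c) \<Rightarrow> real^'c^'r \<Rightarrow> bool" where
  "block_diagonal k ns e ms f X \<longleftrightarrow>
     (\<forall>i<k. \<forall>j<k. i \<noteq> j \<longrightarrow> block ns e ms f X i j = 0\<^sub>m (ns i) (ms j))"

definition fro_norm :: "real mat \<Rightarrow> real" where
  "fro_norm M = sqrt (\<Sum>i<dim_row M. \<Sum>j<dim_col M. (M $$ (i, j))\<^sup>2)"

definition kronecker :: "real mat \<Rightarrow> real mat \<Rightarrow> real mat" where
  "kronecker M N =
     Matrix.mat (dim_row M * dim_row N) (dim_col M * dim_col N)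
       (\<lambda>(i, j). M $$ (i div dim_row N, j div dim_col N) * N $$ (i mod dim_row N, j mod dim_col N))"

(* For square M; a non-square M would have extra zeros here whenever dim_row M < dim_col M. *)
definition singular_values :: "real mat \<Rightarrow> real set" where
  "singular_values M = sqrt ` {l. eigenvalue (transpose_mat M * M) l}"

definition sigma_min :: "real mat \<Rightarrow> real" where
  "sigma_min M = Min (singular_values M)"

definition sep_sharp :: "real mat \<Rightarrow> real mat \<Rightarrow> real" where
  "sep_sharp M N =
     sigma_min (1\<^sub>m (dim_row M * dim_row N) - kronecker (transpose_mat M) (transpose_mat N))"

end

theory Submission
  imports Defs
begin

text \<open>
  For a symmetric positive definite solution \<open>P\<close> of the Riccati equation, completing the square
  (\<open>dare_quadratic_form\<close>) shows that \<open>x \<bullet> P x\<close> is the minimum over all inputs \<open>u\<close> of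
  \<open>(A x - B u) \<bullet> P (A x - B u) + u \<bullet> R u + x \<bullet> Q x\<close>, attained at the optimal feedback, where
  \<open>A x - B u\<close> is the closed-loop state \<open>Acl x\<close>. Three consequences carry the proof.

  \<^item> Freeze the input that is optimal at \<open>A\<close> and perturb \<open>A\<close>. The excess of the resulting cost over
    the optimal one is nonnegative and vanishes at \<open>A\<close>, so its derivative is zero there. This
    envelope argument gives the Stein equation
    \<open>X = Acl\<^sup>T X Acl + Acl\<^sup>T P h + h\<^sup>T P Acl\<close> for \<open>X = DP h\<close>
    (\<open>derivative_solves_stein_equation\<close>), and no inverse has to be differentiated.
  \<^item> As \<open>Q\<close> is positive definite, \<open>Acl\<close> strictly contracts the norm defined by \<open>P\<close>
    (\<open>closed_loop_contraction\<close>). Hence \<open>Y = Acl\<^sup>T Y Acl\<close> forces \<open>Y = 0\<close>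
    (\<open>stein_kernel_trivial\<close>).
  \<^item> A matrix is block diagonal iff it commutes with every diagonal matrix that changes the sign of
    the coordinates of one block. Conjugation by such a matrix leaves uncoupled data unchanged, so
    it fixes the unique solution \<open>P\<close>. Therefore \<open>P\<close> and \<open>Acl\<close> are block diagonal
    (\<open>dare_solution_symmetry\<close>, \<open>block_diagonal_iff_sign_flip\<close>).

  Consequently the Stein equation splits into independent equations for the blocks,
  \<open>X\<^sub>i\<^sub>j - M\<^sup>T X\<^sub>i\<^sub>j N = (P\<^sub>i M)\<^sup>T h\<^sub>i\<^sub>j + h\<^sub>j\<^sub>i\<^sup>T (N\<^sup>T P\<^sub>j)\<^sup>T\<close> with \<open>M\<close> and \<open>N\<close> the diagonal blocks
  \<open>i\<close> and \<open>j\<close> of \<open>Acl\<close>. In row-major coordinates the left-hand side is the Kronecker matrix that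
  defines \<open>sep_sharp M N\<close>, and the smallest singular value bounds it from below by
  \<open>sep_sharp M N\<close> times the norm of \<open>X\<^sub>i\<^sub>j\<close> (\<open>sep_sharp_bound\<close>). The right-hand side is estimated
  by submultiplicativity of the Frobenius norm. One may divide because a kernel element of the
  Kronecker matrix, placed at position \<open>(i, j)\<close> of an otherwise zero matrix, would solve
  \<open>Y = Acl\<^sup>T Y Acl\<close> (\<open>sep_sharp_pos\<close>).
\<close>

section \<open>Inverses and quadratic forms of real matrices\<close>

text \<open>
  By default the simplifier turns \<open>transpose A *v x\<close> into a row-vector product, which hides the
  adjoint that the computations with quadratic forms below move across inner products.
\<close>

declare transpose_matrix_vector [simp del]

lemma matrix_inv_mult:
  fixes S :: "real^'n^'n"
  assumes "invertible S"
  shows "S ** matrix_inv S = mat 1" "matrix_inv S ** S = mat 1"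
  using someI_ex[OF assms[unfolded invertible_def]] by (auto simp: matrix_inv_def)

lemma matrix_inv_eqI:
  fixes S T :: "real^'n^'n"
  assumes "S ** T = mat 1"
  shows "matrix_inv S = T"
proof -
  have TS: "T ** S = mat 1"
    using assms matrix_left_right_inverse by blast
  then have "S ** matrix_inv S = mat 1"
    using assms by (intro matrix_inv_mult) (auto simp: invertible_def)
  then have "T ** (S ** matrix_inv S) = T" by simp
  then show ?thesis by (simp add: matrix_mul_assoc TS)
qed

lemma matrix_inv_mult_vector:
  fixes S :: "real^'n^'n"
  assumes "invertible S"
  shows "S *v (matrix_inv S *v x) = x"
  by (simp add: matrix_vector_mul_assoc matrix_inv_mult[OF assms])

lemma inner_matrix_vector:
  fixes M :: "real^'n^'m"
  shows "x \<bullet> (M *v y) = (transpose M *v x) \<bullet> y"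
  by (metis dot_lmul_matrix transpose_matrix_vector)

lemma inner_transpose_vector:
  fixes M :: "real^'n^'m"
  shows "y \<bullet> (transpose M *v x) = (M *v y) \<bullet> x"
  by (simp add: inner_matrix_vector)

lemma matrix_mult_add_left: "(M + N) ** X = M ** X + N ** X" for X :: "real^'n^'m"
  by (vector matrix_matrix_mult_def sum.distrib distrib_right)

lemma matrix_mult_diff_left: "(M - N) ** X = M ** X - N ** X" for X :: "real^'n^'m"
  by (vector matrix_matrix_mult_def sum_subtractf left_diff_distrib)

lemma matrix_mult_diff_right: "X ** (M - N) = X ** M - X ** N" for X :: "real^'n^'m"
  by (vector matrix_matrix_mult_def sum_subtractf right_diff_distrib)

lemma transpose_add: "transpose (M + N :: real^'n^'m) = transpose M + transpose N"
  by (simp add: transpose_def vec_eq_iff)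

lemma sym_pos_def_inner_commute:
  assumes "sym_pos_def M"
  shows "x \<bullet> (M *v y) = (M *v x) \<bullet> y"
  using assms by (simp add: inner_matrix_vector sym_pos_def_def)

lemma sym_pos_def_nonneg:
  assumes "sym_pos_def M"
  shows "0 \<le> x \<bullet> (M *v x)"
  using assms by (cases "x = 0") (auto simp: sym_pos_def_def less_imp_le)

lemma sym_pos_def_invertible:
  assumes "sym_pos_def M"
  shows "invertible M"
proof -
  have "x = 0" if "M *v x = 0" for x
    using assms that by (force simp: sym_pos_def_def)
  then show ?thesis
    by (simp add: invertible_left_inverse matrix_left_invertible_ker)
qed

lemma sym_pos_def_add_congruence:
  fixes R :: "real^'m^'m" and P :: "real^'n^'n" and B :: "real^'m^'n"
  assumes R: "sym_pos_def R" and P: "sym_pos_def P"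
  shows "sym_pos_def (R + transpose B ** P ** B)"
proof -
  have "0 < x \<bullet> ((R + transpose B ** P ** B) *v x)" if "x \<noteq> 0" for x
  proof -
    have "x \<bullet> ((transpose B ** P ** B) *v x) = (B *v x) \<bullet> (P *v (B *v x))"
      by (simp add: matrix_vector_mul_assoc[symmetric] inner_transpose_vector)
    also have "\<dots> \<ge> 0" by (rule sym_pos_def_nonneg[OF P])
    finally show ?thesis
      using R that
      by (fastforce simp: sym_pos_def_def matrix_vector_mult_add_rdistrib inner_add_right)
  qed
  moreover have "transpose (R + transpose B ** P ** B) = R + transpose B ** P ** B"
    using R P by (simp add: sym_pos_def_def transpose_add matrix_transpose_mul matrix_mul_assoc)
  ultimately show ?thesis by (simp add: sym_pos_def_def)
qed

text \<open>
  Polarisation: a symmetric bilinear form is determined by its quadratic form.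
\<close>

lemma symmetric_form_zero:
  fixes M :: "real^'n^'n"
  assumes sym: "\<And>x y. x \<bullet> (M *v y) = y \<bullet> (M *v x)" and zero: "\<And>x. x \<bullet> (M *v x) = 0"
  shows "M = 0"
proof -
  have "x \<bullet> (M *v y) = 0" for x y
    using zero[of "x + y"] zero[of x] zero[of y] sym[of x y]
    by (simp add: matrix_vector_right_distrib inner_add_left inner_add_right)
  then have "M *v y = 0" for y
    by (metis inner_eq_zero_iff)
  then show ?thesis
    by (simp add: matrix_eq)
qed

lemma bounded_bilinear_matrix_vector_mult:
  "bounded_bilinear ((*v) :: real^'n^'m \<Rightarrow> real^'n \<Rightarrow> real^'m)"
  unfolding bilinear_conv_bounded_bilinear[symmetric] bilinear_def
  by (auto intro!: linearI
      simp: algebra_simps scaleR_matrix_vector_assoc matrix_vector_mult_scaleR)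

section \<open>The Riccati equation as a minimisation\<close>

definition feedback :: "real^'m^'n \<Rightarrow> real^'m^'m \<Rightarrow> real^'n^'n \<Rightarrow> real^'n^'n \<Rightarrow> real^'n^'m" where
  "feedback B R A P = matrix_inv (R + transpose B ** P ** B) ** transpose B ** P ** A"

lemma closed_loop_mult_vector:
  "closed_loop B R A P *v x = A *v x - B *v (feedback B R A P *v x)"
  by (simp add: closed_loop_def feedback_def matrix_vector_mul_assoc matrix_mul_assoc
      matrix_vector_mult_diff_rdistrib)

text \<open>
  Completing the square in \<open>u\<close>: the cost of one step with input \<open>u\<close> followed by the terminal cost
  \<open>P\<close> exceeds the optimal cost by the square of the deviation from the optimal feedback in the
  \<open>S\<close>-norm. The part of the cost quadratic in \<open>u\<close> is \<open>u \<bullet> S u\<close>, and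
  \<open>S K = B\<^sup>T P A\<close> matches the mixed terms.
\<close>

lemma dare_quadratic_form:
  fixes B :: "real^'m^'n"
  assumes dare: "dare B Q R A P" and P: "sym_pos_def P" and R: "sym_pos_def R"
  defines "S \<equiv> R + transpose B ** P ** B" and "K \<equiv> feedback B R A P"
  shows "(A *v x - B *v u) \<bullet> (P *v (A *v x - B *v u)) + u \<bullet> (R *v u) + x \<bullet> (Q *v x)
    = x \<bullet> (P *v x) + (u - K *v x) \<bullet> (S *v (u - K *v x))"
proof -
  let ?a = "A *v x" and ?w = "K *v x"
  have S: "sym_pos_def S"
    unfolding S_def by (rule sym_pos_def_add_congruence[OF R P])
  have "S *v ?w = S *v (matrix_inv S *v (transpose B *v (P *v ?a)))"
    by (simp add: K_def feedback_def S_def matrix_vector_mul_assoc matrix_mul_assoc)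
  then have Sw: "S *v ?w = transpose B *v (P *v ?a)"
    by (simp add: matrix_inv_mult_vector sym_pos_def_invertible S)
  have w: "?w = matrix_inv S *v (transpose B *v (P *v ?a))"
    by (simp add: K_def feedback_def S_def matrix_vector_mul_assoc matrix_mul_assoc)
  have Sv: "S *v v = R *v v + transpose B *v (P *v (B *v v))" for v
    by (simp add: S_def matrix_vector_mult_add_rdistrib matrix_vector_mul_assoc[symmetric])
  have "P *v x = (transpose A ** (P - P ** B ** matrix_inv S ** transpose B ** P) ** A + Q) *v x"
    using dare unfolding dare_def S_def by simp
  also have "\<dots> = transpose A *v (P *v ?a - P *v (B *v ?w)) + Q *v x"
    unfolding w
    by (simp add: matrix_vector_mult_add_rdistrib matrix_vector_mult_diff_rdistrib
        matrix_vector_mul_assoc[symmetric] matrix_vector_mult_diff_distrib)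
  finally have Px: "x \<bullet> (P *v x) = ?a \<bullet> (P *v ?a) - ?a \<bullet> (P *v (B *v ?w)) + x \<bullet> (Q *v x)"
    by (simp add: inner_add_right inner_transpose_vector inner_diff_right)
  have uSu: "u \<bullet> (S *v u) = u \<bullet> (R *v u) + (B *v u) \<bullet> (P *v (B *v u))"
    by (simp add: Sv inner_add_right inner_transpose_vector)
  have uSw: "u \<bullet> (S *v ?w) = (B *v u) \<bullet> (P *v ?a)"
    by (simp add: Sw inner_transpose_vector)
  have wSw: "?w \<bullet> (S *v ?w) = (B *v ?w) \<bullet> (P *v ?a)"
    by (simp add: Sw inner_transpose_vector)
  have wSu: "?w \<bullet> (S *v u) = u \<bullet> (S *v ?w)"
    by (metis S sym_pos_def_inner_commute inner_commute)
  have c1: "?a \<bullet> (P *v (B *v ?w)) = (B *v ?w) \<bullet> (P *v ?a)"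
    and c2: "?a \<bullet> (P *v (B *v u)) = (B *v u) \<bullet> (P *v ?a)"
    by (metis P sym_pos_def_inner_commute inner_commute)+
  show ?thesis
    by (simp add: matrix_vector_mult_diff_distrib inner_diff_left inner_diff_right
        Px uSu uSw wSw wSu c1 c2)
qed

text \<open>
  At the optimal input the square vanishes, so \<open>x \<bullet> P x\<close> decreases along the closed loop by at
  least the positive stage cost \<open>x \<bullet> Q x\<close>.
\<close>

lemma closed_loop_contraction:
  assumes "dare B Q R A P" "sym_pos_def P" "sym_pos_def R" "sym_pos_def Q" "x \<noteq> 0"
  shows "(closed_loop B R A P *v x) \<bullet> (P *v (closed_loop B R A P *v x)) < x \<bullet> (P *v x)"
proof -
  have "0 < x \<bullet> (Q *v x)" using assms by (simp add: sym_pos_def_def)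
  moreover have "0 \<le> (feedback B R A P *v x) \<bullet> (R *v (feedback B R A P *v x))"
    using assms by (simp add: sym_pos_def_nonneg)
  ultimately show ?thesis
    using dare_quadratic_form[OF assms(1-3), of x "feedback B R A P *v x"]
    by (simp add: closed_loop_mult_vector)
qed

section \<open>The homogeneous Stein equation of a contraction\<close>

text \<open>
  Let \<open>c\<close> be the maximum of \<open>(x \<bullet> Y z)\<^sup>2 / ((x \<bullet> P x) (z \<bullet> P z))\<close>, which exists by compactness of
  the unit sphere. Since \<open>x \<bullet> Y z = (M x) \<bullet> Y (M z)\<close> and \<open>M\<close> strictly contracts the \<open>P\<close>-norm, a
  positive \<open>c\<close> would be exceeded at the image of the maximiser under \<open>M\<close>.
\<close>

lemma stein_kernel_trivial:
  fixes M P Y :: "real^'n^'n"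
  assumes P: "sym_pos_def P"
    and contr: "\<And>x. x \<noteq> 0 \<Longrightarrow> (M *v x) \<bullet> (P *v (M *v x)) < x \<bullet> (P *v x)"
    and Y: "Y = transpose M ** Y ** M"
  shows "Y = 0"
proof -
  define p where "p x = x \<bullet> (P *v x)" for x
  define \<phi> where "\<phi> = (\<lambda>(x, z). (x \<bullet> (Y *v z))\<^sup>2 / (p x * p z))"
  let ?K = "sphere (0 :: real^'n) 1 \<times> sphere (0 :: real^'n) 1"
  have p_pos: "0 < p x" if "x \<noteq> 0" for x
    using P that by (simp add: p_def sym_pos_def_def)
  have p_nonneg: "0 \<le> p x" for x
    unfolding p_def by (rule sym_pos_def_nonneg[OF P])
  have contr': "p (M *v x) < p x" if "x \<noteq> 0" for x
    unfolding p_def by (rule contr[OF that])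
  have Y_form: "x \<bullet> (Y *v z) = (M *v x) \<bullet> (Y *v (M *v z))" for x z
    by (subst Y) (simp add: matrix_vector_mul_assoc[symmetric] inner_transpose_vector)
  have "p x \<noteq> 0" if "x \<in> sphere 0 1" for x
    using p_pos[of x] that by force
  then have "continuous_on ?K \<phi>"
    unfolding \<phi>_def p_def case_prod_beta
    by (intro continuous_intros matrix_vector_mult_linear_continuous_on
        continuous_on_compose2[OF matrix_vector_mult_linear_continuous_on])
      (auto simp: p_def)
  moreover have "compact ?K" by (intro compact_Times compact_sphere)
  moreover have "(axis undefined 1, axis undefined 1) \<in> ?K" by simp
  ultimately obtain x0 z0 where x0: "norm x0 = 1" and z0: "norm z0 = 1"
    and max: "\<And>x z. norm x = 1 \<Longrightarrow> norm z = 1 \<Longrightarrow> \<phi> (x, z) \<le> \<phi> (x0, z0)"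
    using continuous_attains_sup[of ?K \<phi>] by (force simp: dist_norm)
  define c where "c = \<phi> (x0, z0)"
  have ne: "x0 \<noteq> 0" "z0 \<noteq> 0" using x0 z0 by auto
  have c_nonneg: "0 \<le> c"
    by (simp add: c_def \<phi>_def p_nonneg)
  have bound: "(x \<bullet> (Y *v z))\<^sup>2 \<le> c * (p x * p z)" for x z
  proof (cases "x = 0 \<or> z = 0")
    case True
    then show ?thesis using c_nonneg p_nonneg by auto
  next
    case False
    \<comment> \<open>The quotient is homogeneous of degree zero in each argument, so unit vectors suffice.\<close>
    have "\<phi> (x, z) = \<phi> (x /\<^sub>R norm x, z /\<^sub>R norm z)"
      using False by (simp add: \<phi>_def p_def matrix_vector_mult_scaleR power2_eq_square field_simps)
    also have "\<dots> \<le> c"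
      unfolding c_def using False by (intro max) auto
    finally show ?thesis
      using False p_pos[of x] p_pos[of z] by (simp add: \<phi>_def divide_simps mult.commute)
  qed
  have "c = 0"
  proof (rule ccontr)
    assume "c \<noteq> 0"
    have "c * (p x0 * p z0) = (x0 \<bullet> (Y *v z0))\<^sup>2"
      using p_pos[OF ne(1)] p_pos[OF ne(2)] by (simp add: c_def \<phi>_def)
    also have "\<dots> \<le> c * (p (M *v x0) * p (M *v z0))"
      by (subst Y_form) (rule bound)
    also have "\<dots> < c * (p x0 * p z0)"
      using \<open>c \<noteq> 0\<close> c_nonneg contr'[OF ne(1)] contr'[OF ne(2)] p_nonneg p_pos[OF ne(2)] p_pos[OF ne(1)]
      by (intro mult_strict_left_mono mult_strict_mono) auto
    finally show False by simp
  qed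
  then have "x \<bullet> (Y *v z) = 0" for x z
    using bound[of x z] by simp
  then have "Y *v z = 0" for z by (metis inner_eq_zero_iff)
  then show ?thesis by (simp add: matrix_eq)
qed

section \<open>The derivative of the Riccati solution\<close>

text \<open>
  The envelope theorem for the optimal cost: the dependence of the optimal feedback on the system
  matrix has no first-order effect. This yields the quadratic form of the identity; the matrix
  identity follows because both sides are symmetric.
\<close>

lemma derivative_solves_stein_equation:
  fixes A Q :: "real^'n^'n" and B :: "real^'m^'n" and p :: "real^'n^'n \<Rightarrow> real^'n^'n"
  assumes sol: "\<forall>\<^sub>F A' in nhds A. sym_pos_def (p A') \<and> dare B Q R A' (p A')"
    and R: "sym_pos_def R"
    and der: "(p has_derivative DP) (at A)"
  defines "M \<equiv> closed_loop B R A (p A)"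
  shows "DP h = transpose M ** DP h ** M + (transpose M ** p A ** h + transpose h ** (p A ** M))"
proof -
  let ?P = "p A"
  have at_A: "sym_pos_def ?P" "dare B Q R A ?P"
    using eventually_nhds_x_imp_x[OF sol] by auto
  have ev: "\<forall>\<^sub>F A' in at A. sym_pos_def (p A') \<and> dare B Q R A' (p A')"
    using sol eventually_nhds_conv_at by blast
  have der_form: "((\<lambda>A'. v A' \<bullet> (p A' *v w A')) has_derivative
      (\<lambda>h. v A \<bullet> (?P *v w' h + DP h *v w A) + v' h \<bullet> (?P *v w A))) (at A)"
    if "(v has_derivative v') (at A)" "(w has_derivative w') (at A)" for v v' w w'
    by (intro has_derivative_inner that
        bounded_bilinear.FDERIV[OF bounded_bilinear_matrix_vector_mult der])
  have const: "((\<lambda>A'. x) has_derivative (\<lambda>h. 0)) (at A)" for x :: "real^'n" by simp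
  have sym: "x \<bullet> (DP h *v y) = y \<bullet> (DP h *v x)" for x y
  proof -
    let ?g = "\<lambda>A'. x \<bullet> (p A' *v y) - y \<bullet> (p A' *v x)"
    have zero: "?g A' = 0" if "sym_pos_def (p A')" for A'
      using sym_pos_def_inner_commute[OF that, of x y] by (simp add: inner_commute)
    have "(?g has_derivative (\<lambda>h. (x \<bullet> (?P *v 0 + DP h *v y) + 0 \<bullet> (?P *v y))
        - (y \<bullet> (?P *v 0 + DP h *v x) + 0 \<bullet> (?P *v x)))) (at A)"
      by (intro has_derivative_diff der_form const)
    moreover have "\<forall>\<^sub>F A' in at A. ?g A \<le> ?g A'"
      using ev by eventually_elim (simp add: zero at_A)
    ultimately have "(\<lambda>h. (x \<bullet> (?P *v 0 + DP h *v y) + 0 \<bullet> (?P *v y))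
        - (y \<bullet> (?P *v 0 + DP h *v x) + 0 \<bullet> (?P *v x))) = (\<lambda>h. 0)"
      by (rule has_derivative_local_min)
    from fun_cong[OF this, of h] show ?thesis by simp
  qed
  have form: "(M *v x) \<bullet> (?P *v (h *v x)) + (M *v x) \<bullet> (DP h *v (M *v x))
      + (h *v x) \<bullet> (?P *v (M *v x)) = x \<bullet> (DP h *v x)" for x
  proof -
    \<comment> \<open>Keep the optimal input at \<^term>\<open>A\<close> while \<^term>\<open>A\<close> is perturbed: the resulting cost
      is at least the optimal one, with equality at \<^term>\<open>A\<close>, so the two agree to first order.\<close>
    define u where "u = feedback B R A ?P *v x"
    define v where "v A' = A' *v x - B *v u" for A'
    let ?g = "\<lambda>A'. v A' \<bullet> (p A' *v v A') - x \<bullet> (p A' *v x)"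
    have vA: "v A = M *v x"
      by (simp add: v_def u_def M_def closed_loop_mult_vector)
    have gap: "?g A' + (u \<bullet> (R *v u) + x \<bullet> (Q *v x))
        = (u - feedback B R A' (p A') *v x)
          \<bullet> ((R + transpose B ** p A' ** B) *v (u - feedback B R A' (p A') *v x))"
      if "sym_pos_def (p A')" "dare B Q R A' (p A')" for A'
      using dare_quadratic_form[OF that(2,1) R, of x u] by (simp add: v_def)
    have lin: "bounded_linear (\<lambda>A'. A' *v x)"
      by (rule bounded_bilinear.bounded_linear_left[OF bounded_bilinear_matrix_vector_mult])
    have dv: "(v has_derivative (\<lambda>h. h *v x)) (at A)"
      unfolding v_def
      using has_derivative_diff[OF bounded_linear_imp_has_derivative[OF lin] const[of "B *v u"]] by simp
    have "(?g has_derivative (\<lambda>h. (v A \<bullet> (?P *v (h *v x) + DP h *v v A) + (h *v x) \<bullet> (?P *v v A))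
        - (x \<bullet> (?P *v 0 + DP h *v x) + 0 \<bullet> (?P *v x)))) (at A)"
      by (intro has_derivative_diff der_form const dv)
    moreover have "\<forall>\<^sub>F A' in at A. ?g A \<le> ?g A'"
      using ev
    proof eventually_elim
      case (elim A')
      have "?g A + (u \<bullet> (R *v u) + x \<bullet> (Q *v x)) = 0"
        using gap[OF at_A] by (simp add: u_def)
      moreover have "0 \<le> ?g A' + (u \<bullet> (R *v u) + x \<bullet> (Q *v x))"
        using elim by (simp add: gap sym_pos_def_nonneg sym_pos_def_add_congruence R)
      ultimately show ?case by simp
    qed
    ultimately have "(\<lambda>h. (v A \<bullet> (?P *v (h *v x) + DP h *v v A) + (h *v x) \<bullet> (?P *v v A))
        - (x \<bullet> (?P *v 0 + DP h *v x) + 0 \<bullet> (?P *v x))) = (\<lambda>h. 0)"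
      by (rule has_derivative_local_min)
    from fun_cong[OF this, of h] show ?thesis by (simp add: vA inner_add_right)
  qed
  define E where "E = transpose M ** DP h ** M + (transpose M ** ?P ** h + transpose h ** (?P ** M)) - DP h"
  have E_form: "x \<bullet> (E *v y) = (M *v x) \<bullet> (DP h *v (M *v y)) + (M *v x) \<bullet> (?P *v (h *v y))
      + (h *v x) \<bullet> (?P *v (M *v y)) - x \<bullet> (DP h *v y)" for x y
    by (simp add: E_def matrix_vector_mult_add_rdistrib matrix_vector_mult_diff_rdistrib
        matrix_vector_mul_assoc[symmetric] inner_add_right inner_diff_right inner_transpose_vector)
  have "E = 0"
  proof (rule symmetric_form_zero)
    show "x \<bullet> (E *v x) = 0" for x
      using form[of x] by (simp add: E_form)
    show "x \<bullet> (E *v y) = y \<bullet> (E *v x)" for x y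
      using sym_pos_def_inner_commute[OF at_A(1), of "M *v x" "h *v y"]
        sym_pos_def_inner_commute[OF at_A(1), of "h *v x" "M *v y"]
        sym[of x y] sym[of "M *v x" "M *v y"]
      by (simp add: E_form inner_commute)
  qed
  then show ?thesis by (simp add: E_def)
qed

section \<open>Symmetries of the Riccati solution\<close>

lemma transpose_intertwine:
  fixes U :: "real^'n^'n" and V :: "real^'m^'m" and X :: "real^'m^'n"
  assumes U: "orthogonal_matrix U" and V: "orthogonal_matrix V" and X: "U ** X = X ** V"
  shows "transpose U ** X = X ** transpose V"
proof -
  have "transpose U ** X = transpose U ** (X ** (V ** transpose V))"
    using V by (simp add: orthogonal_matrix_def)
  also have "\<dots> = transpose U ** (X ** V) ** transpose V" by (simp add: matrix_mul_assoc)
  also have "\<dots> = (transpose U ** U) ** X ** transpose V" by (simp add: X[symmetric] matrix_mul_assoc)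
  also have "\<dots> = X ** transpose V" using U by (simp add: orthogonal_matrix_def)
  finally show ?thesis .
qed

lemma transpose_intertwine':
  fixes U :: "real^'n^'n" and V :: "real^'m^'m" and X :: "real^'m^'n"
  assumes U: "orthogonal_matrix U" and V: "orthogonal_matrix V" and X: "U ** X = X ** V"
  shows "V ** transpose X = transpose X ** U"
  using arg_cong[OF transpose_intertwine[OF U V X], of transpose]
  by (simp add: matrix_transpose_mul)

lemma matrix_inv_intertwine:
  fixes V S :: "real^'m^'m"
  assumes S: "invertible S" and VS: "V ** S = S ** V"
  shows "V ** matrix_inv S = matrix_inv S ** V"
proof -
  have "V ** matrix_inv S = matrix_inv S ** (S ** V) ** matrix_inv S"
    by (simp add: matrix_mul_assoc matrix_inv_mult[OF S])
  also have "\<dots> = matrix_inv S ** V ** (S ** matrix_inv S)"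
    by (simp add: VS[symmetric] matrix_mul_assoc)
  finally show ?thesis by (simp add: matrix_inv_mult[OF S])
qed

lemma sym_pos_def_orthogonal_conjugate:
  fixes P U :: "real^'n^'n"
  assumes P: "sym_pos_def P" and U: "orthogonal_matrix U"
  shows "sym_pos_def (transpose U ** P ** U)"
proof -
  have "0 < x \<bullet> ((transpose U ** P ** U) *v x)" if "x \<noteq> 0" for x
  proof -
    have "transpose U *v (U *v x) = x"
      using U by (simp add: matrix_vector_mul_assoc orthogonal_matrix)
    then have "U *v x \<noteq> 0" using that by force
    then show ?thesis
      using P by (simp add: matrix_vector_mul_assoc[symmetric] inner_transpose_vector sym_pos_def_def)
  qed
  moreover have "transpose (transpose U ** P ** U) = transpose U ** P ** U"
    using P by (simp add: sym_pos_def_def matrix_transpose_mul matrix_mul_assoc)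
  ultimately show ?thesis by (simp add: sym_pos_def_def)
qed

text \<open>
  An orthogonal change of coordinates \<open>U\<close> of the states and \<open>V\<close> of the inputs carries solutions
  of the Riccati equation to solutions for the transformed data. Here the data are invariant, so
  the equation is the same one.
\<close>

lemma dare_orthogonal_conjugate:
  fixes B :: "real^'m^'n"
  assumes U: "orthogonal_matrix U" and V: "orthogonal_matrix V"
    and A: "U ** A = A ** U" and B: "U ** B = B ** V" and Q: "U ** Q = Q ** U" and R: "V ** R = R ** V"
    and P: "sym_pos_def P" and dare: "dare B Q R A P" and pR: "sym_pos_def R"
  shows "dare B Q R A (transpose U ** P ** U)"
proof -
  define P' where "P' = transpose U ** P ** U"
  define S where "S = R + transpose B ** P ** B"
  \<comment> \<open>Passing from \<open>P\<close> to \<open>P'\<close> conjugates \<open>S\<close> by \<open>V\<close>, and hence its inverse as well.\<close>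
  define S' where "S' = R + transpose B ** P' ** B"
  have UU: "transpose U ** U = mat 1" "U ** transpose U = mat 1"
    and VV: "transpose V ** V = mat 1" "V ** transpose V = mat 1"
    using U V by (auto simp: orthogonal_matrix_def)
  have S: "invertible S"
    unfolding S_def by (rule sym_pos_def_invertible[OF sym_pos_def_add_congruence[OF pR P]])
  have R': "transpose V ** R ** V = R"
    using transpose_intertwine[OF V V R] VV by (simp add: matrix_mul_assoc[symmetric])
  have B': "transpose V ** transpose B = transpose B ** transpose U"
    using arg_cong[OF B, of transpose] by (simp add: matrix_transpose_mul)
  have A': "transpose U ** transpose A = transpose A ** transpose U"
    using arg_cong[OF A, of transpose] by (simp add: matrix_transpose_mul)
  have "transpose V ** (transpose B ** P ** B) ** V = (transpose V ** transpose B) ** P ** (B ** V)"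
    by (simp add: matrix_mul_assoc)
  also have "\<dots> = transpose B ** P' ** B"
    by (simp add: B' B[symmetric] P'_def matrix_mul_assoc)
  finally have S'S: "S' = transpose V ** S ** V"
    by (simp add: S'_def S_def matrix_add_ldistrib matrix_mult_add_left R')
  have "S' ** (transpose V ** matrix_inv S ** V) = transpose V ** S ** (V ** transpose V) ** matrix_inv S ** V"
    by (simp add: S'S matrix_mul_assoc)
  also have "\<dots> = transpose V ** (S ** matrix_inv S) ** V"
    unfolding VV by (simp add: matrix_mul_assoc)
  also have "\<dots> = mat 1" by (simp add: matrix_inv_mult[OF S] VV)
  finally have inv: "matrix_inv S' = transpose V ** matrix_inv S ** V"
    by (rule matrix_inv_eqI)
  have PB: "transpose U ** P ** B = P' ** B ** transpose V"
  proof -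
    have "P' ** B ** transpose V = transpose U ** P ** (U ** B) ** transpose V"
      by (simp add: P'_def matrix_mul_assoc)
    also have "\<dots> = transpose U ** P ** B ** (V ** transpose V)"
      by (simp add: B matrix_mul_assoc)
    finally show ?thesis by (simp add: VV)
  qed
  have BP: "transpose B ** P ** U = V ** transpose B ** P'"
  proof -
    have "V ** transpose B ** P' = (V ** transpose B ** transpose U) ** P ** U"
      by (simp add: P'_def matrix_mul_assoc)
    also have "V ** transpose B ** transpose U = transpose B"
      by (metis B' VV(2) matrix_mul_assoc matrix_mul_lid)
    finally show ?thesis by simp
  qed
  define G where "G = P - P ** B ** matrix_inv S ** transpose B ** P"
  have "transpose U ** (P ** B ** matrix_inv S ** transpose B ** P) ** U
      = (transpose U ** P ** B) ** matrix_inv S ** (transpose B ** P ** U)"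
    by (simp add: matrix_mul_assoc)
  also have "\<dots> = P' ** B ** matrix_inv S' ** transpose B ** P'"
    unfolding PB BP inv by (simp add: matrix_mul_assoc)
  finally have G: "transpose U ** G ** U = P' - P' ** B ** matrix_inv S' ** transpose B ** P'"
    by (simp add: G_def P'_def matrix_mult_diff_left matrix_mult_diff_right)
  have "P' = transpose U ** (transpose A ** G ** A + Q) ** U"
    using dare by (simp add: P'_def G_def S_def dare_def)
  also have "\<dots> = (transpose U ** transpose A) ** G ** (A ** U) + transpose U ** Q ** U"
    by (simp add: matrix_add_ldistrib matrix_mult_add_left matrix_mul_assoc)
  also have "transpose U ** Q ** U = Q"
    using transpose_intertwine[OF U U Q] UU by (simp add: matrix_mul_assoc[symmetric])
  also have "(transpose U ** transpose A) ** G ** (A ** U) = transpose A ** (transpose U ** G ** U) ** A"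
    by (simp add: A' A[symmetric] matrix_mul_assoc)
  finally show ?thesis
    unfolding dare_def P'_def[symmetric] G S'_def .
qed

text \<open>
  Uniqueness makes the solution inherit every symmetry of the data, and the closed loop is built from
  matrices that all intertwine the symmetry.
\<close>

lemma dare_solution_symmetry:
  fixes B :: "real^'m^'n"
  assumes ex1: "\<exists>!P. sym_pos_def P \<and> dare B Q R A P"
    and P: "sym_pos_def P" "dare B Q R A P" and R: "sym_pos_def R"
    and U: "orthogonal_matrix U" and V: "orthogonal_matrix V"
    and comm: "U ** A = A ** U" "U ** B = B ** V" "U ** Q = Q ** U" "V ** R = R ** V"
  shows "U ** P = P ** U" and "U ** closed_loop B R A P = closed_loop B R A P ** U"
proof -
  have "transpose U ** P ** U = P"
    using ex1 P dare_orthogonal_conjugate[OF U V comm P R] sym_pos_def_orthogonal_conjugate[OF P(1) U]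
    by blast
  then have "U ** P = U ** (transpose U ** P ** U)" by simp
  then show UP: "U ** P = P ** U"
    using U by (simp add: orthogonal_matrix_def matrix_mul_assoc)
  define S where "S = R + transpose B ** P ** B"
  have Bt: "V ** transpose B = transpose B ** U"
    by (rule transpose_intertwine'[OF U V comm(2)])
  have "V ** (transpose B ** P ** B) = (V ** transpose B) ** P ** B"
    by (simp add: matrix_mul_assoc)
  also have "\<dots> = transpose B ** (U ** P) ** B" by (simp add: Bt matrix_mul_assoc)
  also have "\<dots> = transpose B ** P ** (U ** B)" by (simp add: UP matrix_mul_assoc)
  also have "\<dots> = (transpose B ** P ** B) ** V" by (simp add: comm(2) matrix_mul_assoc)
  finally have "V ** (transpose B ** P ** B) = (transpose B ** P ** B) ** V" .
  then have "V ** S = S ** V"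
    by (simp add: S_def matrix_add_ldistrib matrix_mult_add_left comm(4))
  then have Si: "V ** matrix_inv S = matrix_inv S ** V"
    by (rule matrix_inv_intertwine[rotated])
      (simp add: S_def sym_pos_def_invertible sym_pos_def_add_congruence R P)
  have "U ** (B ** matrix_inv S ** transpose B ** P ** A)
      = (U ** B) ** matrix_inv S ** transpose B ** P ** A" by (simp add: matrix_mul_assoc)
  also have "\<dots> = B ** (V ** matrix_inv S) ** transpose B ** P ** A"
    by (simp add: comm(2) matrix_mul_assoc)
  also have "\<dots> = B ** matrix_inv S ** (V ** transpose B) ** P ** A"
    by (simp add: Si matrix_mul_assoc)
  also have "\<dots> = B ** matrix_inv S ** transpose B ** (U ** P) ** A"
    by (simp add: Bt matrix_mul_assoc)
  also have "\<dots> = B ** matrix_inv S ** transpose B ** P ** (U ** A)"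
    by (simp add: UP matrix_mul_assoc)
  also have "\<dots> = B ** matrix_inv S ** transpose B ** P ** A ** U"
    by (simp add: comm(1) matrix_mul_assoc)
  finally have "U ** (B ** matrix_inv S ** transpose B ** P ** A)
      = B ** matrix_inv S ** transpose B ** P ** A ** U" .
  then show "U ** closed_loop B R A P = closed_loop B R A P ** U"
    by (simp add: closed_loop_def S_def[symmetric] matrix_mult_diff_left matrix_mult_diff_right comm(1))
qed

definition sign_flip :: "'n set \<Rightarrow> real^'n^'n" where
  "sign_flip S = (\<chi> r c. if r = c then (if r \<in> S then - 1 else 1) else 0)"

lemma sign_flip_mult: "(sign_flip S ** X) $ r $ c = (if r \<in> S then - 1 else 1) * X $ r $ c"
  by (simp add: sign_flip_def matrix_matrix_mult_def if_distrib[of "\<lambda>x. x * _"] if_distribR cong: if_cong)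

lemma mult_sign_flip: "(X ** sign_flip S) $ r $ c = X $ r $ c * (if c \<in> S then - 1 else 1)"
  by (simp add: sign_flip_def matrix_matrix_mult_def if_distrib[of "\<lambda>x. _ * x"] cong: if_cong)

lemma orthogonal_sign_flip: "orthogonal_matrix (sign_flip S)"
proof -
  have "transpose (sign_flip S) = sign_flip S"
    by (auto simp: sign_flip_def transpose_def vec_eq_iff)
  moreover have "sign_flip S ** sign_flip S = mat 1"
    by (simp add: vec_eq_iff sign_flip_mult) (simp add: sign_flip_def mat_def)
  ultimately show ?thesis by (simp add: orthogonal_matrix)
qed

lemma sign_flip_intertwine_iff:
  fixes X :: "real^'m^'n"
  shows "sign_flip S ** X = X ** sign_flip T \<longleftrightarrow> (\<forall>r c. (r \<in> S) \<noteq> (c \<in> T) \<longrightarrow> X $ r $ c = 0)"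
  by (auto simp: vec_eq_iff sign_flip_mult mult_sign_flip split: if_splits)

section \<open>The smallest singular value\<close>

text \<open>
  First-order optimality at \<open>t = 0\<close> for a quadratic polynomial with zero constant term.
\<close>

lemma linear_term_zero:
  fixes a c :: real
  assumes "\<And>t. 0 \<le> 2 * t * a + t\<^sup>2 * c"
  shows "a = 0"
proof (rule ccontr)
  assume a: "a \<noteq> 0"
  \<comment> \<open>At \<open>t = - a / k\<close> the linear term dominates as soon as \<open>c < 2 * k\<close>.\<close>
  define k where "k = \<bar>c\<bar> + 1"
  have k: "0 < k" "c < k" by (auto simp: k_def)
  have "0 \<le> 2 * (- a / k) * a + (- a / k)\<^sup>2 * c" by (rule assms)
  also have "\<dots> = (a / k)\<^sup>2 * (c - 2 * k)"
    using k by (simp add: power2_eq_square field_simps)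
  also have "\<dots> < 0" using a k by (simp add: mult_pos_neg)
  finally show False by simp
qed

text \<open>
  The Rayleigh quotient of \<open>M\<^sup>T M\<close> attains its minimum on the unit sphere, and a minimiser is an
  eigenvector by the first-order condition in each coordinate direction. Vectors are represented by
  functions \<open>nat \<Rightarrow> real\<close> that vanish outside \<open>{..<n}\<close>: for these, compactness of the sphere comes
  from the product topology although the dimension \<open>n\<close> is a number and not a type.
\<close>

lemma ex_least_eigenvalue_transpose_mult:
  fixes M :: "real mat"
  assumes M: "M \<in> carrier_mat m n" and n: "0 < n"
  obtains \<mu> where "eigenvalue (transpose_mat M * M) \<mu>"
    and "\<And>v. v \<in> carrier_vec n \<Longrightarrow>
      \<mu> * Matrix.scalar_prod v v \<le> Matrix.scalar_prod (M *\<^sub>v v) (M *\<^sub>v v)"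
proof -
  define L where "L x a = (\<Sum>b<n. M $$ (a, b) * x b)" for x :: "nat \<Rightarrow> real" and a
  define q where "q x = (\<Sum>a<m. (L x a)\<^sup>2)" for x
  define s where "s x = (\<Sum>b<n. (x b)\<^sup>2)" for x :: "nat \<Rightarrow> real"
  define C where "C = (PiE UNIV (\<lambda>b. if b < n then {-1..1} else {0}) :: (nat \<Rightarrow> real) set)"
  have "compactin (product_topology (\<lambda>i. euclidean) UNIV) C"
    unfolding C_def compactin_PiE by auto
  then have "compact C" by (simp add: euclidean_product_topology)
  have cont_s: "continuous_on UNIV s" and cont_q: "continuous_on UNIV q"
    unfolding s_def q_def L_def by (intro continuous_intros continuous_on_product_coordinates)+
  have "closed {x. s x = 1}"
    using closed_Collect_eq[OF cont_s, of "\<lambda>_. 1"] by simp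
  then have K: "compact (C \<inter> {x. s x = 1})"
    using \<open>compact C\<close> by (rule compact_Int_closed[rotated])
  have "(\<lambda>b. if b = 0 then 1 else 0) \<in> C \<inter> {x. s x = 1}"
    using n by (auto simp: C_def s_def PiE_def Pi_def if_distrib[of "\<lambda>x. x\<^sup>2"] cong: if_cong)
  then have "C \<inter> {x. s x = 1} \<noteq> {}" by blast
  then obtain x0 where "x0 \<in> C" and s0: "s x0 = 1"
    and min: "\<And>x. x \<in> C \<Longrightarrow> s x = 1 \<Longrightarrow> q x0 \<le> q x"
    using continuous_attains_inf[OF K _ continuous_on_subset[OF cont_q]] by auto
  define \<mu> where "\<mu> = q x0"
  have ray: "\<mu> * s x \<le> q x" for x
  proof (cases "s x = 0")
    case True
    then show ?thesis by (simp add: q_def sum_nonneg)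
  next
    case False
    then have sx: "0 < s x" by (simp add: s_def sum_nonneg less_le)
    \<comment> \<open>Normalise \<open>x\<close>, and cut it off so that it lies in \<open>C\<close>.\<close>
    define y where "y b = (if b < n then x b / sqrt (s x) else 0)" for b
    have sy: "s y = 1"
      using sx by (simp add: s_def y_def power_divide sum_divide_distrib[symmetric])
    have "L y a = L x a / sqrt (s x)" for a
      by (simp add: L_def y_def sum_divide_distrib)
    then have qy: "q y = q x / s x"
      using sx by (simp add: q_def power_divide sum_divide_distrib)
    have y1: "\<bar>y b\<bar> \<le> 1" if "b < n" for b
    proof -
      have "(y b)\<^sup>2 \<le> s y" unfolding s_def using that by (intro member_le_sum) auto
      then show ?thesis by (simp add: sy abs_square_le_1)
    qed
    have "- 1 \<le> y b \<and> y b \<le> 1" if "b < n" for b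
      using y1[OF that] by linarith
    moreover have "y b = 0" if "\<not> b < n" for b
      using that by (simp add: y_def)
    ultimately have "y \<in> C" by (auto simp: C_def PiE_def Pi_def)
    from min[OF this sy] show ?thesis
      using sx by (simp add: qy \<mu>_def pos_le_divide_eq)
  qed
  have crit: "(\<Sum>a<m. M $$ (a, b) * L x0 a) = \<mu> * x0 b" if b: "b < n" for b
  proof -
    have "0 \<le> 2 * t * ((\<Sum>a<m. M $$ (a, b) * L x0 a) - \<mu> * x0 b)
        + t\<^sup>2 * ((\<Sum>a<m. (M $$ (a, b))\<^sup>2) - \<mu>)" for t
    proof -
      define y where "y = (\<lambda>c. x0 c + (if c = b then t else 0))"
      have "L y a = L x0 a + t * M $$ (a, b)" for a
      proof -
        have "M $$ (a, c) * y c = M $$ (a, c) * x0 c + (if c = b then t * M $$ (a, c) else 0)" for c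
          by (simp add: y_def distrib_left)
        then show ?thesis using b by (simp add: L_def sum.distrib)
      qed
      then have "q y = q x0 + 2 * t * (\<Sum>a<m. M $$ (a, b) * L x0 a) + t\<^sup>2 * (\<Sum>a<m. (M $$ (a, b))\<^sup>2)"
        by (simp add: q_def power2_sum power_mult_distrib sum.distrib sum_distrib_left algebra_simps)
      moreover have "(y c)\<^sup>2 = (x0 c)\<^sup>2 + (if c = b then 2 * t * x0 c + t\<^sup>2 else 0)" for c
        by (simp add: y_def power2_sum)
      then have "s y = s x0 + (2 * t * x0 b + t\<^sup>2)"
        using b by (simp add: s_def sum.distrib)
      ultimately show ?thesis
        using ray[of y] by (simp add: s0 \<mu>_def algebra_simps)
    qed
    from linear_term_zero[OF this] show ?thesis by simp
  qed
  define u where "u = Matrix.vec n x0"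
  have u: "u \<in> carrier_vec n" by (simp add: u_def)
  have Lv: "vec_index (M *\<^sub>v v) a = L (vec_index v) a" if "v \<in> carrier_vec n" "a < m" for v a
    using that M by (auto simp: scalar_prod_def L_def atLeast0LessThan intro!: sum.cong)
  have form: "Matrix.scalar_prod (M *\<^sub>v v) (M *\<^sub>v v) = q (vec_index v)" if "v \<in> carrier_vec n" for v
    using M Lv[OF that] by (simp add: scalar_prod_def q_def power2_eq_square atLeast0LessThan)
  have sform: "Matrix.scalar_prod v v = s (vec_index v)" if "v \<in> carrier_vec n" for v
    using that by (simp add: scalar_prod_def s_def power2_eq_square atLeast0LessThan)
  have Lu: "L (vec_index u) = L x0" by (auto simp: L_def u_def)
  have "transpose_mat M *\<^sub>v (M *\<^sub>v u) = \<mu> \<cdot>\<^sub>v u"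
  proof (rule eq_vecI)
    fix b assume "b < dim_vec (\<mu> \<cdot>\<^sub>v u)"
    then have b: "b < n" by (simp add: u_def)
    have "vec_index (transpose_mat M *\<^sub>v (M *\<^sub>v u)) b = (\<Sum>a<m. M $$ (a, b) * vec_index (M *\<^sub>v u) a)"
      using M b by (simp add: scalar_prod_def atLeast0LessThan)
    also have "\<dots> = (\<Sum>a<m. M $$ (a, b) * L x0 a)"
      using Lv[OF u] by (intro sum.cong refl) (simp only: lessThan_iff Lu)
    finally show "vec_index (transpose_mat M *\<^sub>v (M *\<^sub>v u)) b = vec_index (\<mu> \<cdot>\<^sub>v u) b"
      using crit[OF b] b by (simp add: u_def)
  qed (use M in \<open>auto simp: u_def\<close>)
  moreover have "u \<noteq> 0\<^sub>v n"
  proof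
    assume "u = 0\<^sub>v n"
    then have "x0 b = 0" if "b < n" for b
      using that by (metis index_vec index_zero_vec(1) u_def)
    then have "s x0 = 0" by (simp add: s_def)
    then show False using s0 by simp
  qed
  moreover have "(transpose_mat M * M) *\<^sub>v u = transpose_mat M *\<^sub>v (M *\<^sub>v u)"
    using M by (intro assoc_mult_mat_vec) (auto simp: u_def)
  ultimately have "eigenvalue (transpose_mat M * M) \<mu>"
    using M u by (auto simp: eigenvalue_def eigenvector_def)
  then show ?thesis
    by (rule that) (simp add: form sform ray)
qed

lemma finite_singular_values:
  fixes M :: "real mat"
  assumes M: "M \<in> carrier_mat n n"
  shows "finite (singular_values M)"
proof -
  have G: "transpose_mat M * M \<in> carrier_mat n n" using M by auto
  have "char_poly (transpose_mat M * M) \<noteq> 0"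
    using degree_monic_char_poly[OF G] by force
  then have "finite {l. poly (char_poly (transpose_mat M * M)) l = 0}"
    by (rule poly_roots_finite)
  then show ?thesis
    by (simp add: singular_values_def eigenvalue_root_char_poly[OF G])
qed

text \<open>
  The eigenvalue that bounds the Rayleigh quotient is one of those over which \<open>sigma_min\<close> is
  minimised, so the bound holds a fortiori for the minimum.
\<close>

lemma sigma_min_bound:
  fixes M :: "real mat"
  assumes M: "M \<in> carrier_mat n n" and n: "0 < n" and v: "v \<in> carrier_vec n"
  shows "sigma_min M * sqrt (Matrix.scalar_prod v v) \<le> sqrt (Matrix.scalar_prod (M *\<^sub>v v) (M *\<^sub>v v))"
proof -
  obtain \<mu> where \<mu>: "eigenvalue (transpose_mat M * M) \<mu>"
    and bound: "\<mu> * Matrix.scalar_prod v v \<le> Matrix.scalar_prod (M *\<^sub>v v) (M *\<^sub>v v)"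
    using ex_least_eigenvalue_transpose_mult[OF M n] v by metis
  have "0 \<le> Matrix.scalar_prod v v" by (simp add: scalar_prod_def sum_nonneg)
  moreover have "sigma_min M \<le> sqrt \<mu>"
    unfolding sigma_min_def using \<mu>
    by (intro Min_le finite_singular_values[OF M]) (auto simp: singular_values_def)
  ultimately have "sigma_min M * sqrt (Matrix.scalar_prod v v) \<le> sqrt \<mu> * sqrt (Matrix.scalar_prod v v)"
    by (intro mult_right_mono) auto
  also have "\<dots> \<le> sqrt (Matrix.scalar_prod (M *\<^sub>v v) (M *\<^sub>v v))"
    using bound by (simp add: real_sqrt_mult[symmetric])
  finally show ?thesis .
qed

text \<open>
  For an eigenvector \<open>v\<close> of \<open>M\<^sup>T M\<close> the eigenvalue is the quotient of the squared lengths of \<open>M v\<close>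
  and \<open>v\<close>, hence positive when \<open>M\<close> has trivial kernel.
\<close>

lemma sigma_min_pos:
  fixes M :: "real mat"
  assumes M: "M \<in> carrier_mat n n" and n: "0 < n"
    and ker: "\<And>v. v \<in> carrier_vec n \<Longrightarrow> M *\<^sub>v v = 0\<^sub>v n \<Longrightarrow> v = 0\<^sub>v n"
  shows "0 < sigma_min M"
proof -
  have self: "0 < Matrix.scalar_prod w w" if "w \<in> carrier_vec n" "w \<noteq> 0\<^sub>v n" for w :: "real Matrix.vec"
  proof -
    obtain b where "b < n" "vec_index w b \<noteq> 0" using \<open>w \<in> carrier_vec n\<close> \<open>w \<noteq> 0\<^sub>v n\<close> by fastforce
    then show ?thesis
      using that by (auto simp: scalar_prod_def intro!: sum_pos2[of _ b] simp: not_less[symmetric] zero_less_mult_iff)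
  qed
  have "0 < l" if "eigenvalue (transpose_mat M * M) l" for l
  proof -
    from that obtain v where v: "v \<in> carrier_vec n" "v \<noteq> 0\<^sub>v n" and ev: "(transpose_mat M * M) *\<^sub>v v = l \<cdot>\<^sub>v v"
      using M by (auto simp: eigenvalue_def eigenvector_def)
    have Mv: "M *\<^sub>v v \<in> carrier_vec n" using M v by auto
    have "l * Matrix.scalar_prod v v = Matrix.scalar_prod (transpose_mat M *\<^sub>v (M *\<^sub>v v)) v"
      using M v ev by (simp flip: assoc_mult_mat_vec)
    also have "\<dots> = Matrix.scalar_prod (M *\<^sub>v v) (M *\<^sub>v v)"
      using M v Mv by (intro transpose_vec_mult_scalar) auto
    also have "\<dots> > 0" using self[OF Mv] ker[OF v(1)] v(2) by blast
    finally show "0 < l" using self[OF v] by (simp add: zero_less_mult_iff)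
  qed
  moreover have "singular_values M \<noteq> {}"
    using ex_least_eigenvalue_transpose_mult[OF M n] by (auto simp: singular_values_def)
  ultimately show ?thesis
    unfolding sigma_min_def using finite_singular_values[OF M]
    by (subst Min_gr_iff) (auto simp: singular_values_def)
qed

section \<open>Row-major vectorisation\<close>

definition vec_rows :: "'a mat \<Rightarrow> 'a Matrix.vec" where
  "vec_rows X = Matrix.vec (dim_row X * dim_col X) (\<lambda>k. X $$ (k div dim_col X, k mod dim_col X))"

lemma sum_div_mod:
  fixes g :: "nat \<Rightarrow> nat \<Rightarrow> 'a::comm_monoid_add"
  shows "(\<Sum>k<p * q. g (k div q) (k mod q)) = (\<Sum>a<p. \<Sum>b<q. g a b)"
proof -
  have "(\<Sum>k<p * q. g (k div q) (k mod q)) = (\<Sum>a<p. \<Sum>k = a * q..<a * q + q. g (k div q) (k mod q))"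
    by (rule sum.nat_group[symmetric])
  also have "\<dots> = (\<Sum>a<p. \<Sum>b<q. g a b)"
  proof (rule sum.cong[OF refl])
    fix a
    show "(\<Sum>k = a * q..<a * q + q. g (k div q) (k mod q)) = (\<Sum>b<q. g a b)"
      using sum.shift_bounds_nat_ivl[of "\<lambda>k. g (k div q) (k mod q)" 0 "a * q" q]
      by (simp add: add.commute atLeast0LessThan)
  qed
  finally show ?thesis .
qed

lemma fro_norm_vec_rows: "fro_norm X = sqrt (Matrix.scalar_prod (vec_rows X) (vec_rows X))"
  using sum_div_mod[of "\<lambda>a b. (X $$ (a, b))\<^sup>2" "dim_col X" "dim_row X"]
  by (simp add: fro_norm_def scalar_prod_def vec_rows_def atLeast0LessThan power2_eq_square)

lemma div_mod_less: "k < p * q \<Longrightarrow> k div q < p \<and> k mod q < q" for k p q :: nat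
  by (cases "q = 0") (auto simp: less_mult_imp_div_less)

text \<open>
  Row-major vectorisation is the ordering for which \<open>F \<otimes> G\<close> acts on \<open>vec X\<close> as
  \<open>X \<mapsto> F X G\<^sup>T\<close>. Thus the matrix in the definition of \<open>sep_sharp\<close> represents exactly the Stein
  operator \<open>X \<mapsto> X - M\<^sup>T X N\<close>.
\<close>

lemma kronecker_mult_vec_rows:
  fixes M N X :: "real mat"
  assumes M: "M \<in> carrier_mat p p" and N: "N \<in> carrier_mat q q" and X: "X \<in> carrier_mat p q"
  shows "(1\<^sub>m (p * q) - kronecker (transpose_mat M) (transpose_mat N)) *\<^sub>v vec_rows X
    = vec_rows (X - transpose_mat M * X * N)"
proof (rule eq_vecI)
  fix k assume "k < dim_vec (vec_rows (X - transpose_mat M * X * N))"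
  then have k: "k < p * q" using M N X by (simp add: vec_rows_def)
  define a b where "a = k div q" and "b = k mod q"
  have ab: "a < p" "b < q" using div_mod_less[OF k] by (auto simp: a_def b_def)
  have "vec_index ((1\<^sub>m (p * q) - kronecker (transpose_mat M) (transpose_mat N)) *\<^sub>v vec_rows X) k
     = (\<Sum>l<p * q. ((if k = l then 1 else 0) - M $$ (l div q, a) * N $$ (l mod q, b)) * X $$ (l div q, l mod q))"
    using M N X k by (auto simp: scalar_prod_def vec_rows_def kronecker_def atLeast0LessThan
        div_mod_less a_def b_def intro!: sum.cong)
  also have "\<dots> = X $$ (a, b) - (\<Sum>l<p * q. M $$ (l div q, a) * N $$ (l mod q, b) * X $$ (l div q, l mod q))"
    using k by (simp add: left_diff_distrib sum_subtractf a_def b_def if_distrib[of "\<lambda>x. x * _"] cong: if_cong)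
  also have "(\<Sum>l<p * q. M $$ (l div q, a) * N $$ (l mod q, b) * X $$ (l div q, l mod q))
     = (\<Sum>c<p. \<Sum>d<q. M $$ (c, a) * N $$ (d, b) * X $$ (c, d))"
    by (rule sum_div_mod)
  also have "\<dots> = (\<Sum>d<q. (\<Sum>c<p. M $$ (c, a) * X $$ (c, d)) * N $$ (d, b))"
    by (subst sum.swap) (simp add: sum_distrib_left sum_distrib_right ac_simps)
  also have "\<dots> = (transpose_mat M * X * N) $$ (a, b)"
    using M N X ab by (simp add: scalar_prod_def atLeast0LessThan del: assoc_mult_mat)
  finally show "vec_index ((1\<^sub>m (p * q) - kronecker (transpose_mat M) (transpose_mat N)) *\<^sub>v vec_rows X) k
     = vec_index (vec_rows (X - transpose_mat M * X * N)) k"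
    using M N X k ab by (simp add: vec_rows_def a_def b_def)
qed (use M N X in \<open>auto simp: vec_rows_def kronecker_def\<close>)

lemma sep_sharp_bound:
  fixes M N X :: "real mat"
  assumes M: "M \<in> carrier_mat p p" and N: "N \<in> carrier_mat q q" and X: "X \<in> carrier_mat p q"
    and pos: "0 < p" "0 < q"
  shows "sep_sharp M N * fro_norm X \<le> fro_norm (X - transpose_mat M * X * N)"
proof -
  have "sigma_min (1\<^sub>m (p * q) - kronecker (transpose_mat M) (transpose_mat N)) * fro_norm X
    \<le> fro_norm (X - transpose_mat M * X * N)"
    unfolding fro_norm_vec_rows kronecker_mult_vec_rows[OF M N X, symmetric]
    using M N X pos by (intro sigma_min_bound) (auto simp: kronecker_def vec_rows_def)
  then show ?thesis using M N by (simp add: sep_sharp_def)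
qed

lemma sep_sharp_pos:
  fixes M N :: "real mat"
  assumes M: "M \<in> carrier_mat p p" and N: "N \<in> carrier_mat q q" and pos: "0 < p" "0 < q"
    and ker: "\<And>X. X \<in> carrier_mat p q \<Longrightarrow> X = transpose_mat M * X * N \<Longrightarrow> X = 0\<^sub>m p q"
  shows "0 < sep_sharp M N"
proof -
  have "0 < sigma_min (1\<^sub>m (p * q) - kronecker (transpose_mat M) (transpose_mat N))"
  proof (rule sigma_min_pos)
    fix v assume v: "v \<in> carrier_vec (p * q)"
      and zero: "(1\<^sub>m (p * q) - kronecker (transpose_mat M) (transpose_mat N)) *\<^sub>v v = 0\<^sub>v (p * q)"
    define X where "X = Matrix.mat p q (\<lambda>(a, b). vec_index v (a * q + b))"
    have X: "X \<in> carrier_mat p q" by (simp add: X_def)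
    have vX: "v = vec_rows X"
      using v by (auto simp: vec_rows_def X_def div_mod_less)
    have entries: "vec_index (vec_rows Z) (a * q + b) = Z $$ (a, b)"
      if "Z \<in> carrier_mat p q" "a < p" "b < q" for a b and Z :: "real mat"
    proof -
      have "a * q + b < p * q"
        using that mult_le_mono1[of "Suc a" p q] by simp
      then show ?thesis using that by (simp add: vec_rows_def)
    qed
    have Z: "X - transpose_mat M * X * N \<in> carrier_mat p q" using M N X by auto
    have "vec_rows (X - transpose_mat M * X * N) = 0\<^sub>v (p * q)"
      using zero unfolding vX kronecker_mult_vec_rows[OF M N X] .
    then have eq: "(X - transpose_mat M * X * N) $$ (a, b) = 0" if "a < p" "b < q" for a b
      using entries[OF Z that] that mult_le_mono1[of "Suc a" p q] by simp
    have "X = transpose_mat M * X * N"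
    proof (rule eq_matI)
      fix a b assume "a < dim_row (transpose_mat M * X * N)" "b < dim_col (transpose_mat M * X * N)"
      then have "a < p" "b < q" using M N by auto
      from eq[OF this] this show "X $$ (a, b) = (transpose_mat M * X * N) $$ (a, b)"
        using M N X by simp
    qed (use M N X in auto)
    from ker[OF X this] show "v = 0\<^sub>v (p * q)"
      unfolding vX by (auto simp: vec_rows_def div_mod_less)
  qed (use M N pos in \<open>auto simp: kronecker_def\<close>)
  then show ?thesis using M N by (simp add: sep_sharp_def)
qed

section \<open>The Frobenius norm\<close>

lemma fro_norm_nonneg: "0 \<le> fro_norm X"
  by (simp add: fro_norm_def sum_nonneg)

lemma fro_norm_transpose: "fro_norm (transpose_mat X) = fro_norm X"
  unfolding fro_norm_def by (subst sum.swap) simp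

lemma fro_norm_add_le:
  fixes X Y :: "real mat"
  assumes "X \<in> carrier_mat p q" "Y \<in> carrier_mat p q"
  shows "fro_norm (X + Y) \<le> fro_norm X + fro_norm Y"
proof -
  have fro: "fro_norm Z = L2_set (\<lambda>(a, b). Z $$ (a, b)) ({..<p} \<times> {..<q})" if "Z \<in> carrier_mat p q" for Z
    using that by (simp add: fro_norm_def L2_set_def sum.cartesian_product case_prod_beta)
  have "fro_norm (X + Y) = L2_set (\<lambda>z. (case z of (a, b) \<Rightarrow> X $$ (a, b)) + (case z of (a, b) \<Rightarrow> Y $$ (a, b)))
      ({..<p} \<times> {..<q})"
    using assms by (subst fro) (auto intro!: L2_set_cong)
  also have "\<dots> \<le> fro_norm X + fro_norm Y"
    unfolding fro[OF assms(1)] fro[OF assms(2)] by (rule L2_set_triangle_ineq)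
  finally show ?thesis .
qed

text \<open>
  Cauchy-Schwarz in every entry of the product.
\<close>

lemma fro_norm_mult_le:
  fixes X Y :: "real mat"
  assumes X: "X \<in> carrier_mat p q" and Y: "Y \<in> carrier_mat q r"
  shows "fro_norm (X * Y) \<le> fro_norm X * fro_norm Y"
proof -
  have "(\<Sum>a<p. \<Sum>c<r. ((X * Y) $$ (a, c))\<^sup>2)
      = (\<Sum>a<p. \<Sum>c<r. (\<Sum>b<q. X $$ (a, b) * Y $$ (b, c))\<^sup>2)"
    using X Y by (intro sum.cong refl) (simp add: scalar_prod_def atLeast0LessThan)
  also have "\<dots> \<le> (\<Sum>a<p. \<Sum>c<r. (\<Sum>b<q. (X $$ (a, b))\<^sup>2) * (\<Sum>b<q. (Y $$ (b, c))\<^sup>2))"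
    by (intro sum_mono Cauchy_Schwarz_ineq_sum)
  also have "\<dots> = (\<Sum>a<p. \<Sum>b<q. (X $$ (a, b))\<^sup>2) * (\<Sum>c<r. \<Sum>b<q. (Y $$ (b, c))\<^sup>2)"
    by (simp add: sum_product)
  also have "(\<Sum>c<r. \<Sum>b<q. (Y $$ (b, c))\<^sup>2) = (\<Sum>b<q. \<Sum>c<r. (Y $$ (b, c))\<^sup>2)"
    by (rule sum.swap)
  finally show ?thesis
    using X Y by (simp add: fro_norm_def real_sqrt_mult[symmetric])
qed

section \<open>Block matrices\<close>

text \<open>
  The coordinate at position \<open>a\<close> inside block \<open>i\<close>. Pairs \<open>(i, a)\<close> index the coordinates
  bijectively (\<open>coord_eq_iff\<close>, \<open>ex_coord\<close>), which spares later arguments the block offsets.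
\<close>

definition coord :: "(nat \<Rightarrow> nat) \<Rightarrow> (nat \<Rightarrow> 'n) \<Rightarrow> nat \<Rightarrow> nat \<Rightarrow> 'n" where
  "coord ns e i a = e ((\<Sum>l<i. ns l) + a)"

lemma offset_less:
  fixes ns :: "nat \<Rightarrow> nat"
  assumes "i < j" "a < ns i"
  shows "(\<Sum>l<i. ns l) + a < (\<Sum>l<j. ns l)"
proof -
  have "(\<Sum>l<i. ns l) + a < (\<Sum>l<Suc i. ns l)" using assms by simp
  also have "\<dots> \<le> (\<Sum>l<j. ns l)" using assms by (intro sum_mono2) auto
  finally show ?thesis .
qed

lemma coord_eq_iff:
  assumes e: "partition_enum k ns e" and "i < k" "j < k" "a < ns i" "b < ns j"
  shows "coord ns e i a = coord ns e j b \<longleftrightarrow> i = j \<and> a = b"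
proof
  assume eq: "coord ns e i a = coord ns e j b"
  have "inj_on e {..<(\<Sum>l<k. ns l)}"
    using e by (simp add: partition_enum_def bij_betw_def)
  then have off: "(\<Sum>l<i. ns l) + a = (\<Sum>l<j. ns l) + b"
    using eq assms by (auto simp: coord_def offset_less dest: inj_onD)
  have "i = j"
    using offset_less[where ns = ns and i = i and j = j and a = a]
      offset_less[where ns = ns and i = j and j = i and a = b] assms off
    by (cases i j rule: linorder_cases) auto
  then show "i = j \<and> a = b" using off by simp
qed simp

lemma ex_coord:
  assumes e: "partition_enum k ns e"
  obtains i a where "i < k" "a < ns i" "r = coord ns e i a"
proof -
  have "r \<in> e ` {..<(\<Sum>l<k. ns l)}"
    using e by (simp add: partition_enum_def bij_betw_def)
  then obtain x where x: "x < (\<Sum>l<k. ns l)" "r = e x"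
    by blast
  have "\<exists>i<k. \<exists>a<ns i. x = (\<Sum>l<i. ns l) + a"
    using x(1)
  proof (induction k)
    case (Suc k)
    show ?case
    proof (cases "x < (\<Sum>l<k. ns l)")
      case True
      then show ?thesis using Suc.IH less_Suc_eq by blast
    next
      case False
      then show ?thesis
        using Suc.prems by (intro exI[of _ k]) (auto intro!: exI[of _ "x - (\<Sum>l<k. ns l)"])
    qed
  qed simp
  then show ?thesis using that x(2) by (auto simp: coord_def)
qed

lemma sum_coord:
  fixes g :: "'n::finite \<Rightarrow> 'a::comm_monoid_add"
  assumes e: "partition_enum k ns e"
  shows "sum g UNIV = (\<Sum>i<k. \<Sum>a<ns i. g (coord ns e i a))"
proof -
  let ?I = "SIGMA i:{..<k}. {..<ns i}"
  have "inj_on (\<lambda>(i, a). coord ns e i a) ?I"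
    by (auto simp: inj_on_def coord_eq_iff[OF e])
  moreover have "r \<in> (\<lambda>(i, a). coord ns e i a) ` ?I" for r
  proof -
    obtain i a where "i < k" "a < ns i" "r = coord ns e i a" by (rule ex_coord[OF e])
    then show ?thesis by (intro image_eqI[of _ _ "(i, a)"]) auto
  qed
  then have "(\<lambda>(i, a). coord ns e i a) ` ?I = UNIV" by blast
  ultimately have "sum g UNIV = (\<Sum>(i, a)\<in>?I. g (coord ns e i a))"
    by (subst sum.reindex_cong[of "\<lambda>(i, a). coord ns e i a" ?I]) (auto simp: case_prod_beta)
  then show ?thesis by (simp add: sum.Sigma)
qed

lemma dim_block [simp]:
  "dim_row (block ns e ms f X i j) = ns i" "dim_col (block ns e ms f X i j) = ms j"
  by (simp_all add: block_def)

lemma block_carrier [simp]: "block ns e ms f X i j \<in> carrier_mat (ns i) (ms j)"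
  by (simp add: block_def)

lemma index_block [simp]:
  "a < ns i \<Longrightarrow> b < ms j \<Longrightarrow> block ns e ms f X i j $$ (a, b) = X $ coord ns e i a $ coord ms f j b"
  by (simp add: block_def coord_def)

lemma block_add: "block ns e ms f (X + Y) i j = block ns e ms f X i j + block ns e ms f Y i j"
  by (rule eq_matI) auto

lemma block_transpose: "block ms f ns e (transpose X) j i = transpose_mat (block ns e ms f X i j)"
  by (rule eq_matI) (auto simp: transpose_def)

lemma blocks_eqI:
  fixes X Y :: "real^'m^'n"
  assumes e: "partition_enum k ns e" and f: "partition_enum k ms f"
    and eq: "\<And>i j. i < k \<Longrightarrow> j < k \<Longrightarrow> block ns e ms f X i j = block ns e ms f Y i j"
  shows "X = Y"
proof -
  have "X $ r $ c = Y $ r $ c" for r c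
  proof -
    obtain i a where r: "i < k" "a < ns i" "r = coord ns e i a" by (rule ex_coord[OF e])
    obtain j b where c: "j < k" "b < ms j" "c = coord ms f j b" by (rule ex_coord[OF f])
    show ?thesis using arg_cong[OF eq[OF r(1) c(1)], of "\<lambda>Z. Z $$ (a, b)"] r c by simp
  qed
  then show ?thesis by (simp add: vec_eq_iff)
qed

text \<open>
  This transports a solution of a blockwise equation to one of the full matrix equation.
\<close>

lemma ex_single_block:
  fixes Z :: "real mat" and e :: "nat \<Rightarrow> 'n::finite" and f :: "nat \<Rightarrow> 'm::finite"
  assumes e: "partition_enum k ns e" and f: "partition_enum k ms f" and ij: "i < k" "j < k"
    and Z: "Z \<in> carrier_mat (ns i) (ms j)"
  obtains X :: "real^'m^'n" where "block ns e ms f X i j = Z"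
    and "\<And>i' j'. i' < k \<Longrightarrow> j' < k \<Longrightarrow> (i', j') \<noteq> (i, j) \<Longrightarrow> block ns e ms f X i' j' = 0\<^sub>m (ns i') (ms j')"
proof -
  define X :: "real^'m^'n" where
    "X = (\<chi> r c. \<Sum>a<ns i. \<Sum>b<ms j. if r = coord ns e i a \<and> c = coord ms f j b then Z $$ (a, b) else 0)"
  have X: "X $ coord ns e i' a' $ coord ms f j' b' = (if (i', j') = (i, j) then Z $$ (a', b') else 0)"
    if "i' < k" "j' < k" "a' < ns i'" "b' < ms j'" for i' j' a' b'
  proof (cases "(i', j') = (i, j)")
    case True
    have "X $ coord ns e i' a' $ coord ms f j' b'
        = (\<Sum>a<ns i. \<Sum>b<ms j. if a' = a then (if b' = b then Z $$ (a, b) else 0) else 0)"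
      unfolding X_def using True that
      by (auto simp: coord_eq_iff[OF e] coord_eq_iff[OF f] intro!: sum.cong)
    also have "\<dots> = (\<Sum>a<ns i. if a' = a then (\<Sum>b<ms j. if b' = b then Z $$ (a, b) else 0) else 0)"
      by (intro sum.cong) auto
    also have "\<dots> = Z $$ (a', b')" using True that by simp
    finally show ?thesis using True by simp
  next
    case False
    then show ?thesis
      unfolding X_def using that ij
      by (auto simp: coord_eq_iff[OF e] coord_eq_iff[OF f] intro!: sum.neutral)
  qed
  have "block ns e ms f X i j = Z"
    by (rule eq_matI) (use Z ij in \<open>auto simp: X\<close>)
  moreover have "block ns e ms f X i' j' = 0\<^sub>m (ns i') (ms j')"
    if "i' < k" "j' < k" "(i', j') \<noteq> (i, j)" for i' j'
    by (rule eq_matI) (use that in \<open>auto simp: X\<close>)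
  ultimately show ?thesis by (rule that)
qed

lemma block_diagonal_iff:
  "block_diagonal k ns e ms f X \<longleftrightarrow>
    (\<forall>i<k. \<forall>j<k. i \<noteq> j \<longrightarrow> (\<forall>a<ns i. \<forall>b<ms j. X $ coord ns e i a $ coord ms f j b = 0))"
proof -
  have "block ns e ms f X i j = 0\<^sub>m (ns i) (ms j) \<longleftrightarrow>
      (\<forall>a<ns i. \<forall>b<ms j. X $ coord ns e i a $ coord ms f j b = 0)" for i j
    by (auto simp: mat_eq_iff)
  then show ?thesis by (simp add: block_diagonal_def)
qed

text \<open>
  In row \<open>i\<close> of a block diagonal factor only the diagonal block contributes to the product.
\<close>

lemma block_mult_left:
  assumes p: "partition_enum k ms f" and i: "i < k" and j: "j < k"
    and X: "block_diagonal k ns e ms f X"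
  shows "block ns e qs g (X ** Y) i j = block ns e ms f X i i * block ms f qs g Y i j"
proof (rule eq_matI)
  fix a b
  assume "a < dim_row (block ns e ms f X i i * block ms f qs g Y i j)"
    and "b < dim_col (block ns e ms f X i i * block ms f qs g Y i j)"
  then have ab: "a < ns i" "b < qs j" by auto
  let ?r = "coord ns e i a" and ?c = "coord qs g j b"
  have "(X ** Y) $ ?r $ ?c = (\<Sum>l<k. \<Sum>d<ms l. X $ ?r $ coord ms f l d * Y $ coord ms f l d $ ?c)"
    by (simp add: matrix_matrix_mult_def sum_coord[OF p])
  also have "\<dots> = (\<Sum>l\<in>{i}. \<Sum>d<ms l. X $ ?r $ coord ms f l d * Y $ coord ms f l d $ ?c)"
    using X i ab by (intro sum.mono_neutral_right) (auto simp: block_diagonal_iff intro!: sum.neutral)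
  finally show "block ns e qs g (X ** Y) i j $$ (a, b)
      = (block ns e ms f X i i * block ms f qs g Y i j) $$ (a, b)"
    using ab by (simp add: scalar_prod_def atLeast0LessThan)
qed auto

lemma block_diagonal_transpose:
  "block_diagonal k ns e ms f X \<Longrightarrow> block_diagonal k ms f ns e (transpose X)"
  by (simp add: block_diagonal_iff transpose_def)

text \<open>
  The transpose of the corresponding rule for a block diagonal left factor.
\<close>

lemma block_mult_right:
  assumes p: "partition_enum k ms f" and i: "i < k" and j: "j < k"
    and Y: "block_diagonal k ms f qs g Y"
  shows "block ns e qs g (X ** Y) i j = block ns e ms f X i j * block ms f qs g Y j j"
proof -
  have "block qs g ns e (transpose Y ** transpose X) j i
      = block qs g ms f (transpose Y) j j * block ms f ns e (transpose X) j i"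
    by (rule block_mult_left[OF p j i block_diagonal_transpose[OF Y]])
  then have "transpose_mat (block ns e qs g (X ** Y) i j)
      = transpose_mat (block ns e ms f X i j * block ms f qs g Y j j)"
    by (subst transpose_mult[OF block_carrier block_carrier])
      (simp add: block_transpose flip: matrix_transpose_mul)
  then show ?thesis by (metis Matrix.transpose_transpose)
qed

definition block_coords :: "(nat \<Rightarrow> nat) \<Rightarrow> (nat \<Rightarrow> 'n) \<Rightarrow> nat \<Rightarrow> 'n set" where
  "block_coords ns e i = coord ns e i ` {..<ns i}"

lemma coord_in_block_coords:
  assumes "partition_enum k ns e" "i < k" "l < k" "a < ns i"
  shows "coord ns e i a \<in> block_coords ns e l \<longleftrightarrow> i = l"
  using assms by (auto simp: block_coords_def coord_eq_iff)

text \<open>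
  Commuting with the sign change of block \<open>l\<close> means that the entries between block \<open>l\<close> and its
  complement vanish. This turns block diagonality into an algebraic symmetry, which passes to
  products and inverses and which the Riccati equation respects.
\<close>

lemma block_diagonal_iff_sign_flip:
  fixes X :: "real^'m^'n"
  assumes e: "partition_enum k ns e" and f: "partition_enum k ms f"
  shows "block_diagonal k ns e ms f X \<longleftrightarrow>
    (\<forall>l<k. sign_flip (block_coords ns e l) ** X = X ** sign_flip (block_coords ms f l))"
proof
  assume X: "block_diagonal k ns e ms f X"
  have "X $ r $ c = 0"
    if "l < k" "(r \<in> block_coords ns e l) \<noteq> (c \<in> block_coords ms f l)" for l r c
  proof -
    obtain i a where r: "i < k" "a < ns i" "r = coord ns e i a" by (rule ex_coord[OF e])
    obtain j b where c: "j < k" "b < ms j" "c = coord ms f j b" by (rule ex_coord[OF f])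
    have "i \<noteq> j"
      using that r c by (auto simp: coord_in_block_coords[OF e] coord_in_block_coords[OF f])
    then show ?thesis using X r c by (simp add: block_diagonal_iff)
  qed
  then show "\<forall>l<k. sign_flip (block_coords ns e l) ** X = X ** sign_flip (block_coords ms f l)"
    by (auto simp: sign_flip_intertwine_iff)
next
  assume *: "\<forall>l<k. sign_flip (block_coords ns e l) ** X = X ** sign_flip (block_coords ms f l)"
  show "block_diagonal k ns e ms f X"
    unfolding block_diagonal_iff
  proof (intro allI impI)
    fix i j a b assume "i < k" "j < k" "i \<noteq> j" "a < ns i" "b < ms j"
    then have "(coord ns e i a \<in> block_coords ns e i) \<noteq> (coord ms f j b \<in> block_coords ms f i)"
      by (simp add: coord_in_block_coords[OF e] coord_in_block_coords[OF f])
    then show "X $ coord ns e i a $ coord ms f j b = 0"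
      using * \<open>i < k\<close> by (simp add: sign_flip_intertwine_iff)
  qed
qed

section \<open>The perturbation bound\<close>

theorem theorem7:
  fixes A Q P Acl dA :: "real^'n^'n"
    and B :: "real^'m^'n"
    and R :: "real^'m^'m"
    and DP :: "real^'n^'n \<Rightarrow> real^'n^'n"
    and k i j :: nat
    and ns ms :: "nat \<Rightarrow> nat"
    and e :: "nat \<Rightarrow> 'n"
    and f :: "nat \<Rightarrow> 'm"
  assumes "k \<ge> 2"
    and "partition_enum k ns e"
    and "partition_enum k ms f"
    and "block_diagonal k ns e ns e A"
    and "block_diagonal k ns e ms f B"
    and "block_diagonal k ns e ns e Q"
    and "block_diagonal k ms f ms f R"
    and "sym_pos_def Q"
    and "sym_pos_def R"
    and "\<forall>\<^sub>F A' in nhds A. \<exists>!P'. sym_pos_def P' \<and> dare B Q R A' P'"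
    and "(dare_sol B Q R has_derivative DP) (at A)"
    and "P = dare_sol B Q R A"
    and "Acl = closed_loop B R A P"
    and "i < k"
    and "j < k"
  shows "fro_norm (block ns e ns e (DP dA) i j)
    \<le> (fro_norm (block ns e ns e P i i * block ns e ns e Acl i i)
        + fro_norm (transpose_mat (block ns e ns e Acl j j) * block ns e ns e P j j))
      / sep_sharp (block ns e ns e Acl i i) (block ns e ns e Acl j j)
      * max (fro_norm (block ns e ns e dA i j)) (fro_norm (block ns e ns e dA j i))"
proof -
  note pe = \<open>partition_enum k ns e\<close> and pf = \<open>partition_enum k ms f\<close>
  note ij = \<open>i < k\<close> \<open>j < k\<close>
  note Q = \<open>sym_pos_def Q\<close> and R = \<open>sym_pos_def R\<close>
  note unique = \<open>\<forall>\<^sub>F A' in nhds A. \<exists>!P'. sym_pos_def P' \<and> dare B Q R A' P'\<close>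
  note der = \<open>(dare_sol B Q R has_derivative DP) (at A)\<close>
  note P_def = \<open>P = dare_sol B Q R A\<close> and Acl_def = \<open>Acl = closed_loop B R A P\<close>
  have sol: "\<forall>\<^sub>F A' in nhds A. sym_pos_def (dare_sol B Q R A') \<and> dare B Q R A' (dare_sol B Q R A')"
    using unique by eventually_elim (unfold dare_sol_def, rule theI')
  have ex1: "\<exists>!P'. sym_pos_def P' \<and> dare B Q R A P'"
    using eventually_nhds_x_imp_x[OF unique] .
  have P: "sym_pos_def P" "dare B Q R A P"
    using eventually_nhds_x_imp_x[OF sol] P_def by auto
  have sym: "transpose P = P" using P by (simp add: sym_pos_def_def)

  have "sign_flip (block_coords ns e l) ** P = P ** sign_flip (block_coords ns e l) \<and>
      sign_flip (block_coords ns e l) ** Acl = Acl ** sign_flip (block_coords ns e l)"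
    if l: "l < k" for l
  proof -
    have "sign_flip (block_coords ns e l) ** A = A ** sign_flip (block_coords ns e l)"
      "sign_flip (block_coords ns e l) ** B = B ** sign_flip (block_coords ms f l)"
      "sign_flip (block_coords ns e l) ** Q = Q ** sign_flip (block_coords ns e l)"
      "sign_flip (block_coords ms f l) ** R = R ** sign_flip (block_coords ms f l)"
      using assms(4-7) l
      by (simp_all add: block_diagonal_iff_sign_flip[OF pe pe] block_diagonal_iff_sign_flip[OF pe pf]
          block_diagonal_iff_sign_flip[OF pf pf])
    from dare_solution_symmetry[OF ex1 P R orthogonal_sign_flip orthogonal_sign_flip this]
    show ?thesis by (simp add: Acl_def)
  qed
  then have bdP: "block_diagonal k ns e ns e P" and bdAcl: "block_diagonal k ns e ns e Acl"
    by (simp_all add: block_diagonal_iff_sign_flip[OF pe pe])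
  have bdAclT: "block_diagonal k ns e ns e (transpose Acl)"
    by (rule block_diagonal_transpose[OF bdAcl])

  let ?blk = "\<lambda>X. block ns e ns e X"
  let ?M = "?blk Acl i i" and ?N = "?blk Acl j j" and ?Pi = "?blk P i i" and ?Pj = "?blk P j j"
  let ?X = "?blk (DP dA) i j" and ?H = "?blk dA i j" and ?H' = "?blk dA j i"
  \<comment> \<open>Block diagonality of \<open>Acl\<close> makes the Stein operator act on each block separately.\<close>
  have congr: "?blk (transpose Acl ** Y ** Acl) i' j' = transpose_mat (?blk Acl i' i') * ?blk Y i' j' * ?blk Acl j' j'"
    if "i' < k" "j' < k" for Y i' j'
    by (simp only: block_mult_right[OF pe that bdAcl] block_mult_left[OF pe that bdAclT] block_transpose)
  have sym_block: "transpose_mat (?blk P l l) = ?blk P l l" for l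
    by (simp flip: block_transpose add: sym)

  have sep_pos: "0 < sep_sharp ?M ?N"
  proof (rule sep_sharp_pos)
    show "0 < ns i" "0 < ns j" using pe ij by (auto simp: partition_enum_def)
    fix Z assume Z: "Z \<in> carrier_mat (ns i) (ns j)" and fixp: "Z = transpose_mat ?M * Z * ?N"
    \<comment> \<open>Contractivity is known for all of \<open>Acl\<close>, so a kernel element of the block operator is extended by
      zero to the full space.\<close>
    obtain Y :: "real^'n^'n" where Y: "?blk Y i j = Z"
      and Y0: "\<And>i' j'. i' < k \<Longrightarrow> j' < k \<Longrightarrow> (i', j') \<noteq> (i, j) \<Longrightarrow> ?blk Y i' j' = 0\<^sub>m (ns i') (ns j')"
      using ex_single_block[OF pe pe ij Z] by blast
    have Y_stein: "Y = transpose Acl ** Y ** Acl"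
    proof (rule blocks_eqI[OF pe pe])
      fix i' j' assume i': "i' < k" "j' < k"
      show "?blk Y i' j' = ?blk (transpose Acl ** Y ** Acl) i' j'"
      proof (cases "(i', j') = (i, j)")
        case True
        then show ?thesis using fixp by (simp add: congr[OF ij] Y)
      next
        case False
        have "transpose_mat (?blk Acl i' i') * 0\<^sub>m (ns i') (ns j') = 0\<^sub>m (ns i') (ns j')"
          by (rule right_mult_zero_mat) simp
        then show ?thesis
          unfolding congr[OF i'] Y0[OF i' False] by (simp add: left_mult_zero_mat[OF block_carrier])
      qed
    qed
    have "(Acl *v x) \<bullet> (P *v (Acl *v x)) < x \<bullet> (P *v x)" if "x \<noteq> 0" for x
      unfolding Acl_def by (rule closed_loop_contraction[OF P(2,1) R Q that])
    then have "Y = 0"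
      by (rule stein_kernel_trivial[OF P(1) _ Y_stein])
    then show "Z = 0\<^sub>m (ns i) (ns j)"
      unfolding Y[symmetric] by (intro eq_matI) auto
  qed auto

  have "DP dA = transpose Acl ** DP dA ** Acl + (transpose Acl ** P ** dA + transpose dA ** (P ** Acl))"
    using derivative_solves_stein_equation[OF sol R der] by (simp add: P_def Acl_def)
  then have "?X = ?blk (transpose Acl ** DP dA ** Acl + (transpose Acl ** P ** dA + transpose dA ** (P ** Acl))) i j"
    by simp
  also have "\<dots> = transpose_mat ?M * ?X * ?N + (?blk (transpose Acl ** (P ** dA)) i j + ?blk (transpose dA ** P ** Acl) i j)"
    by (simp add: block_add congr ij matrix_mul_assoc)
  also have "?blk (transpose Acl ** (P ** dA)) i j = transpose_mat ?M * (?Pi * ?H)"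
    by (simp only: block_mult_left[OF pe ij bdAclT] block_mult_left[OF pe ij bdP] block_transpose)
  also have "?blk (transpose dA ** P ** Acl) i j = transpose_mat ?H' * ?Pj * ?N"
    by (simp only: block_mult_right[OF pe ij bdAcl] block_mult_right[OF pe ij bdP] block_transpose)
  finally have stein: "?X = transpose_mat ?M * ?X * ?N
      + (transpose_mat ?M * (?Pi * ?H) + transpose_mat ?H' * ?Pj * ?N)" .
  have assoc: "transpose_mat ?M * (?Pi * ?H) = transpose_mat (?Pi * ?M) * ?H"
    "transpose_mat ?H' * ?Pj * ?N = transpose_mat ?H' * transpose_mat (transpose_mat ?N * ?Pj)"
    by (simp_all add: transpose_mult[OF block_carrier block_carrier] sym_block
        transpose_mult[of "transpose_mat ?N" "ns j" "ns j" ?Pj "ns j"]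
        assoc_mult_mat[of _ "ns i" "ns i" _ "ns i" _ "ns j"] assoc_mult_mat[of _ "ns i" "ns j" _ "ns j" _ "ns j"])
  have "?X - transpose_mat ?M * ?X * ?N = transpose_mat ?M * (?Pi * ?H) + transpose_mat ?H' * ?Pj * ?N"
    (is "_ - ?Z = ?W")
  proof (rule eq_matI)
    fix a b assume "a < dim_row ?W" "b < dim_col ?W"
    then show "(?X - ?Z) $$ (a, b) = ?W $$ (a, b)"
      using arg_cong[OF stein, of "\<lambda>Y. Y $$ (a, b)"] by (simp del: index_mult_mat(1) assoc_mult_mat index_block)
  qed auto
  then have "sep_sharp ?M ?N * fro_norm ?X
      \<le> fro_norm (transpose_mat (?Pi * ?M) * ?H + transpose_mat ?H' * transpose_mat (transpose_mat ?N * ?Pj))"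
    using sep_sharp_bound[of ?M "ns i" ?N "ns j" ?X] pe ij unfolding assoc
    by (simp add: partition_enum_def)
  also have "\<dots> \<le> fro_norm (transpose_mat (?Pi * ?M) * ?H)
      + fro_norm (transpose_mat ?H' * transpose_mat (transpose_mat ?N * ?Pj))"
    by (rule fro_norm_add_le[of _ "ns i" "ns j"]) auto
  also have "\<dots> \<le> fro_norm (?Pi * ?M) * fro_norm ?H + fro_norm ?H' * fro_norm (transpose_mat ?N * ?Pj)"
  proof -
    have "?Pi * ?M \<in> carrier_mat (ns i) (ns i)" "transpose_mat ?N * ?Pj \<in> carrier_mat (ns j) (ns j)"
      by (auto intro: mult_carrier_mat)
    then show ?thesis
      using fro_norm_mult_le[of "transpose_mat (?Pi * ?M)" "ns i" "ns i" ?H "ns j"]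
        fro_norm_mult_le[of "transpose_mat ?H'" "ns i" "ns j" "transpose_mat (transpose_mat ?N * ?Pj)" "ns j"]
      by (simp add: fro_norm_transpose add_mono)
  qed
  also have "\<dots> \<le> (fro_norm (?Pi * ?M) + fro_norm (transpose_mat ?N * ?Pj)) * max (fro_norm ?H) (fro_norm ?H')"
    unfolding distrib_right mult.commute[of "fro_norm ?H'"]
    by (intro add_mono mult_left_mono fro_norm_nonneg) auto
  finally show ?thesis
    using sep_pos by (simp add: pos_le_divide_eq mult.commute)
qed

end
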